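(* Fix integers $l,m\ge1$ (and positive integers $n,k,r$). Suppose that for each $1\le i\le m$ we have random vectors $X^i=(X^i_1,\ldots,X^i_n)\in\mathcal{A}^r(n,k)$ and $Y^i=(Y^i_1,\ldots,Y^i_n)\in\mathcal{A}^r(n,lk+l+k)$. Suppose that the vectors $X^1,\ldots,X^m$ are independent among themselves and independent from the family of vectors $(Y^1,\ldots,Y^m)$, and that the vectors $Y^1,\ldots,Y^m$ are $l$-wise independent among themselves (any at most $l$ of these random vectors are independent). Then the vector with the $mn$ coordinates $$X^i_j+Y^i_j\quad(1\le i\le m,\ 1\le j\le n)$$ (addition in $\mathbb{Z}_r$) is in $\mathcal{A}^r(mn,lk+l+k)$.
   Context: $\mathbb{Z}_r$ is the cyclic group of size $r$. $\mathcal{A}^r(n,k)$ is the set of all $k$-wise independent distributions of vectors $(X_1,\ldots,X_n)\in\mathbb{Z}_r^n$ with each $X_i$ uniform in $\mathbb{Z}_r$, where $k$-wise independent means that any at most $k$ of the coordinates are independent (all coordinates are independent if $k\ge n$). Writing that a random vector is in $\mathcal{A}^r(n,k)$ means that its distribution is. *)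

theory Defs
  imports "HOL-Probability.Probability" "HOL-Algebra.Elementary_Groups"
begin

abbreviation cyc :: "nat \<Rightarrow> int set" where
  "cyc r \<equiv> carrier (integer_mod_group r)"

text \<open>The library's \<open>integer_mod_group r\<close> has carrier \<open>{0..<r}\<close> and addition modulo \<open>r\<close>
  if \<open>r > 0\<close>; for \<open>r = 0\<close> it is the group of all integers.\<close>

definition vec_space :: "nat \<Rightarrow> 'i set \<Rightarrow> ('i \<Rightarrow> int) measure" where
  "vec_space r I = PiM I (\<lambda>_. count_space (cyc r))"

definition (in prob_space) kwise_indep_vars ::
    "nat \<Rightarrow> ('i \<Rightarrow> 'b measure) \<Rightarrow> ('i \<Rightarrow> 'a \<Rightarrow> 'b) \<Rightarrow> 'i set \<Rightarrow> bool" where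
  "kwise_indep_vars k N X I \<longleftrightarrow>
     (\<forall>J\<subseteq>I. finite J \<and> card J \<le> k \<longrightarrow> indep_vars N X J)"

text \<open>Coordinates are indexed by an arbitrary finite set \<open>I\<close>, so \<open>\<A>\<^sup>r(n,k)\<close> is
  \<open>kwise_dists r I k\<close> for any \<open>I\<close> with \<open>n\<close> elements: \<open>{1..n}\<close> for the vectors of length \<open>n\<close>,
  \<open>{1..m} \<times> {1..n}\<close> for a vector whose \<open>m * n\<close> coordinates carry two indices.\<close>

definition kwise_dists :: "nat \<Rightarrow> 'i set \<Rightarrow> nat \<Rightarrow> ('i \<Rightarrow> int) measure set" where
  "kwise_dists r I k =
     {P. prob_space P \<and> sets P = sets (vec_space r I) \<and>
         (\<forall>i\<in>I. distr P (count_space (cyc r)) (\<lambda>x. x i) = uniform_count_measure (cyc r)) \<and>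
         prob_space.kwise_indep_vars P k (\<lambda>_. count_space (cyc r)) (\<lambda>i x. x i) I}"

text \<open>Measurability is required explicitly, since \<open>distr\<close> is total. It also forces the vectors
  to be extensional, i.e. \<open>undefined\<close> outside \<open>I\<close>.\<close>

definition random_vector_in ::
    "'a measure \<Rightarrow> ('a \<Rightarrow> 'i \<Rightarrow> int) \<Rightarrow> nat \<Rightarrow> 'i set \<Rightarrow> nat \<Rightarrow> bool" where
  "random_vector_in M X r I k \<longleftrightarrow>
     X \<in> measurable M (vec_space r I) \<and> distr M (vec_space r I) X \<in> kwise_dists r I k"

end

theory Submission imports Defs begin

text \<open>Let \<open>S\<close> be a set of at most \<open>l k + l + k = (l + 1) (k + 1) - 1\<close> index pairs, and call a row \<open>i\<close>
  heavy if \<open>S\<close> has more than \<open>k\<close> pairs in it. There are at most \<open>l\<close> heavy rows, so on them the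
  coordinates of \<open>Y\<close> in \<open>S\<close> are jointly uniform, while on the light rows those of \<open>X\<close> are. Since the
  \<open>X\<^sup>i\<close> are independent of each other and of \<open>Y\<close>, the light part of \<open>X\<close> masks the light part of the
  sum independently of its heavy part, which in turn is masked by the heavy part of \<open>Y\<close>. Note that
  the heavy and light parts of \<open>Y\<close> may depend on each other, so the order of these two steps
  matters.\<close>

section \<open>Arithmetic and measurability for \<open>cyc r\<close>\<close>

lemma cyc_pos: "r \<ge> 1 \<Longrightarrow> cyc r = {0..<int r}"
  by (simp add: carrier_integer_mod_group)

text \<open>Members of \<open>cyc r\<close> are reduced residues, so congruence modulo
  \<open>r\<close> between them is equality; \<open>v\<close> may be any integer.\<close>

lemma add_mod_eq_iff:
  assumes "r \<ge> 1" "u \<in> cyc r" "z \<in> cyc r"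
  shows "(u + v) mod int r = z \<longleftrightarrow> u = (z - v) mod int r"
proof -
  have "u mod int r = u" "z mod int r = z"
    using assms by (auto simp: cyc_pos)
  then show ?thesis
    by (metis add_diff_cancel_right' diff_add_cancel mod_add_left_eq mod_diff_left_eq)
qed

lemma finite_cyc: "r \<ge> 1 \<Longrightarrow> finite (cyc r)"
  by (simp add: cyc_pos)

text \<open>Every subset of a discrete space is measurable, so \<open>P\<close> can be arbitrary;
  finiteness of \<open>S\<close> makes the conjunction a finite intersection.\<close>

lemma sets_Ball_count_space:
  assumes "finite S" "\<And>s. s \<in> S \<Longrightarrow> Z s \<in> measurable M (count_space C)"
  shows "{\<omega> \<in> space M. \<forall>s\<in>S. P s (Z s \<omega>)} \<in> sets M"
proof (intro sets.sets_Collect_finite_All[OF _ assms(1)])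
  fix s assume "s \<in> S"
  then have Z: "Z s \<in> measurable M (count_space C)"
    by (rule assms(2))
  have "{\<omega> \<in> space M. P s (Z s \<omega>)} = Z s -` {c \<in> C. P s c} \<inter> space M"
    using measurable_space[OF Z] by auto
  then show "{\<omega> \<in> space M. P s (Z s \<omega>)} \<in> sets M"
    using measurable_sets[OF Z, of "{c \<in> C. P s c}"] by simp
qed

lemma measurable_add_mod:
  assumes "r \<ge> 1" "U \<in> measurable M (count_space (cyc r))" "V \<in> measurable M (count_space (cyc r))"
  shows "(\<lambda>\<omega>. (U \<omega> + V \<omega>) mod int r) \<in> measurable M (count_space (cyc r))"
proof -
  \<comment> \<open>The product of two countable discrete spaces is again discrete, so any map on
    the pairs, addition included, is measurable.\<close>
  have "(\<lambda>\<omega>. (U \<omega>, V \<omega>)) \<in> measurable M (count_space (cyc r \<times> cyc r))"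
    using measurable_Pair[OF assms(2,3)] finite_cyc[OF assms(1)]
    by (simp add: pair_measure_count_space countable_finite)
  moreover have "(\<lambda>(u, v). (u + v) mod int r) \<in>
      measurable (count_space (cyc r \<times> cyc r)) (count_space (cyc r))"
    using assms(1) by (auto simp: cyc_pos)
  ultimately show ?thesis
    by (drule_tac measurable_compose) (assumption, simp)
qed

lemma measurable_vec_space_component:
  "j \<in> I \<Longrightarrow> (\<lambda>x. x j) \<in> measurable (vec_space r I) (count_space (cyc r))"
  by (simp add: vec_space_def)

text \<open>A whole family of vectors is treated here as one point of a product space. This is the
  form in which the independence of the \<open>X\<close> family from the \<open>Y\<close> family is
  given.\<close>

lemma sets_PiM_vec_space_Ball:
  assumes "finite S" "S \<subseteq> I \<times> J"
  shows "{x \<in> space (PiM I (\<lambda>_. vec_space r J)). \<forall>p\<in>S. x (fst p) (snd p) = z p} \<in>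
    sets (PiM I (\<lambda>_. vec_space r J))"
proof (rule sets_Ball_count_space[OF assms(1), where Z="\<lambda>p x. x (fst p) (snd p)" and C="cyc r"])
  fix p assume "p \<in> S"
  then have "fst p \<in> I" "snd p \<in> J"
    using assms(2) by auto
  then show "(\<lambda>x. x (fst p) (snd p)) \<in> measurable (PiM I (\<lambda>_. vec_space r J)) (count_space (cyc r))"
    using measurable_compose[OF measurable_component_singleton[of "fst p" I "\<lambda>_. vec_space r J"]
        measurable_vec_space_component] by blast
qed

context prob_space
begin

section \<open>Event probabilities under independence, and total probability\<close>

lemma indep_vars_prob_Ball:
  assumes "indep_vars N X I" "finite I"
    and "\<And>i. i \<in> I \<Longrightarrow> {x \<in> space (N i). P i x} \<in> sets (N i)"
  shows "prob {\<omega> \<in> space M. \<forall>i\<in>I. P i (X i \<omega>)} =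
    (\<Prod>i\<in>I. prob {\<omega> \<in> space M. P i (X i \<omega>)})"
\<comment> \<open>For \<open>I = {}\<close> the intersection below would be \<open>UNIV\<close>
  instead of \<open>space M\<close>.\<close>
proof (cases "I = {}")
  case False
  have "{\<omega> \<in> space M. \<forall>i\<in>I. P i (X i \<omega>)} = (\<Inter>i\<in>I. {\<omega> \<in> space M. P i (X i \<omega>)})"
    using False by auto
  then show ?thesis
    using indep_eventsI_indep_vars[OF assms(1,3)] False assms(2)
    by (simp add: indep_events_def)
qed (simp add: prob_space)

lemma indep_var_prob_conj:
  assumes "indep_var N X N' Y"
    and "{x \<in> space N. P x} \<in> sets N" "{y \<in> space N'. Q y} \<in> sets N'"
  shows "prob {\<omega> \<in> space M. P (X \<omega>) \<and> Q (Y \<omega>)} =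
    prob {\<omega> \<in> space M. P (X \<omega>)} * prob {\<omega> \<in> space M. Q (Y \<omega>)}"
proof -
  have "X \<in> measurable M N" "Y \<in> measurable M N'"
    using assms(1) by (auto dest: indep_var_rv1 indep_var_rv2)
  note [dest] = this[THEN measurable_space]
  have "(\<lambda>\<omega>. (X \<omega>, Y \<omega>)) -` ({x \<in> space N. P x} \<times> {y \<in> space N'. Q y}) \<inter> space M =
      {\<omega> \<in> space M. P (X \<omega>) \<and> Q (Y \<omega>)}"
    "X -` {x \<in> space N. P x} \<inter> space M = {\<omega> \<in> space M. P (X \<omega>)}"
    "Y -` {y \<in> space N'. Q y} \<inter> space M = {\<omega> \<in> space M. Q (Y \<omega>)}"
    by auto
  then show ?thesis
    using indep_varD[OF assms] by simp
qed

text \<open>Law of total probability over the values of \<open>Z\<close> on \<open>S\<close>, with a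
  side event \<open>Q\<close>. Members of \<open>PiE S A\<close> are determined by their values on
  \<open>S\<close>, so distinct \<open>z\<close> give disjoint events, and there are finitely many
  of them.\<close>

lemma prob_sum_PiE:
  assumes S: "finite S" "\<And>s. s \<in> S \<Longrightarrow> Z s \<in> measurable M (count_space C)"
    and A: "\<And>s. s \<in> S \<Longrightarrow> finite (A s)"
    and E: "{\<omega> \<in> space M. Q \<omega>} \<in> events"
  shows "prob {\<omega> \<in> space M. Q \<omega> \<and> (\<forall>s\<in>S. Z s \<omega> \<in> A s)} =
    (\<Sum>z\<in>PiE S A. prob {\<omega> \<in> space M. Q \<omega> \<and> (\<forall>s\<in>S. Z s \<omega> = z s)})"
proof -
  let ?F = "\<lambda>z. {\<omega> \<in> space M. Q \<omega> \<and> (\<forall>s\<in>S. Z s \<omega> = z s)}"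
  have "{\<omega> \<in> space M. Q \<omega> \<and> (\<forall>s\<in>S. Z s \<omega> \<in> A s)} = (\<Union>z\<in>PiE S A. ?F z)"
  proof (intro equalityI subsetI)
    fix \<omega> assume "\<omega> \<in> {\<omega> \<in> space M. Q \<omega> \<and> (\<forall>s\<in>S. Z s \<omega> \<in> A s)}"
    then show "\<omega> \<in> (\<Union>z\<in>PiE S A. ?F z)"
      by (intro UN_I[of "\<lambda>s\<in>S. Z s \<omega>"]) auto
  qed (auto simp: PiE_mem)
  moreover have "disjoint_family_on ?F (PiE S A)"
    unfolding disjoint_family_on_def
  proof (intro ballI impI equals0I)
    fix z z' \<omega> assume "z \<in> PiE S A" "z' \<in> PiE S A" "z \<noteq> z'" "\<omega> \<in> ?F z \<inter> ?F z'"
    then show False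
      using PiE_ext[of z S A z'] by fastforce
  qed
  moreover have "?F z \<in> events" for z
    using sets.Int[OF E sets_Ball_count_space[OF S, where P="\<lambda>s x. x = z s"]]
    by (rule back_subst[where P="\<lambda>E. E \<in> events"]) auto
  ultimately show ?thesis
    using finite_measure_finite_Union[of "PiE S A" ?F] finite_PiE[of S A] S(1) A
    by (simp add: image_subset_iff)
qed

section \<open>Joint uniformity as a condition on point probabilities\<close>

text \<open>For finite \<open>S\<close> and \<open>C\<close> and measurable \<open>Z\<close> this
  expresses uniformity on the product C^S, that is, uniform marginals and independence in a single
  numerical identity. Since \<open>z\<close> is taken from \<open>S \<rightarrow> C\<close> and not
  from \<open>PiE\<close>, instances need not be extensional.\<close>

definition point_uniform :: "'c set \<Rightarrow> ('i \<Rightarrow> 'a \<Rightarrow> 'c) \<Rightarrow> 'i set \<Rightarrow> bool" where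
  "point_uniform C Z S \<longleftrightarrow> (\<forall>z\<in>S \<rightarrow> C.
     prob {\<omega> \<in> space M. \<forall>s\<in>S. Z s \<omega> = z s} = (1 / card C) ^ card S)"

text \<open>The box \<open>PiE S A\<close> has as many points as the product of the
  \<open>card (A s)\<close>, each of mass \<open>(1 / card C) ^ card S\<close>.\<close>

lemma point_uniform_prob:
  assumes "finite S" "finite C" "\<And>s. s \<in> S \<Longrightarrow> Z s \<in> measurable M (count_space C)"
    and "point_uniform C Z S"
    and A: "\<And>s. s \<in> S \<Longrightarrow> A s \<subseteq> C"
  shows "prob {\<omega> \<in> space M. \<forall>s\<in>S. Z s \<omega> \<in> A s} = (\<Prod>s\<in>S. card (A s) / card C)"
proof -
  have "prob {\<omega> \<in> space M. \<forall>s\<in>S. Z s \<omega> \<in> A s} =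
      (\<Sum>z\<in>PiE S A. prob {\<omega> \<in> space M. \<forall>s\<in>S. Z s \<omega> = z s})"
    using prob_sum_PiE[of S Z C A "\<lambda>_. True"] assms by (auto dest: finite_subset)
  also have "\<dots> = (\<Sum>z\<in>PiE S A. (1 / card C) ^ card S)"
    using assms(4) A by (intro sum.cong refl) (fastforce simp: point_uniform_def)
  also have "\<dots> = (\<Prod>s\<in>S. card (A s) / card C)"
    using assms(1) by (simp add: card_PiE prod_dividef power_one_over divide_simps)
  finally show ?thesis .
qed

text \<open>By \<open>point_uniform_prob\<close>, applied to \<open>S\<close> and to singletons, the
  joint probability and the product of the marginal ones are both the product of the
  \<open>card (A s) / card C\<close>.\<close>

lemma point_uniform_indep_vars:
  assumes "finite S" "finite C" "\<And>s. s \<in> S \<Longrightarrow> Z s \<in> measurable M (count_space C)"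
    and "\<And>R. R \<subseteq> S \<Longrightarrow> point_uniform C Z R"
  shows "indep_vars (\<lambda>_. count_space C) Z S"
proof (cases "S = {}")
  case False
  show ?thesis
  \<comment> \<open>Since \<open>A j = C\<close> is allowed and imposes no condition at
    \<open>j\<close>, the product formula over all of \<open>S\<close> covers its subfamilies as
    well.\<close>
  proof (subst indep_vars_finite[where E="\<lambda>_. Pow C"])
    show "\<forall>A\<in>(\<Pi> i\<in>S. Pow C). prob (\<Inter>j\<in>S. Z j -` A j \<inter> space M) =
        (\<Prod>j\<in>S. prob (Z j -` A j \<inter> space M))"
    proof
      fix A assume A: "A \<in> (\<Pi> i\<in>S. Pow C)"
      have "(\<Inter>j\<in>S. Z j -` A j \<inter> space M) = {\<omega> \<in> space M. \<forall>s\<in>S. Z s \<omega> \<in> A s}"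
        using False by auto
      then have "prob (\<Inter>j\<in>S. Z j -` A j \<inter> space M) = (\<Prod>s\<in>S. card (A s) / card C)"
        using point_uniform_prob[of S C Z A] A assms by fastforce
      also have "\<dots> = (\<Prod>j\<in>S. prob (Z j -` A j \<inter> space M))"
      proof (intro prod.cong refl)
        fix j assume "j \<in> S"
        moreover have "Z j -` A j \<inter> space M = {\<omega> \<in> space M. Z j \<omega> \<in> A j}"
          by auto
        ultimately show "card (A j) / card C = prob (Z j -` A j \<inter> space M)"
          using point_uniform_prob[of "{j}" C Z A] A assms by fastforce
      qed
      finally show "prob (\<Inter>j\<in>S. Z j -` A j \<inter> space M) =
        (\<Prod>j\<in>S. prob (Z j -` A j \<inter> space M))" .
    qed
  qed (use False assms in \<open>auto simp: Int_stable_def sigma_algebra.sigma_sets_eq[OF sigma_algebra_Pow]\<close>)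
qed (simp add: indep_vars_def indep_sets_def)

text \<open>This turns the condition in \<open>kwise_dists\<close> into finite counting. By
  \<open>k \<ge> 1\<close> the singletons are among the sets \<open>S\<close> on the right, which
  gives back the uniform marginals.\<close>

lemma uniform_coords_kwise_indep_iff:
  assumes "finite I" "finite C" "C \<noteq> {}" "k \<ge> 1"
    and Z: "\<And>i. i \<in> I \<Longrightarrow> Z i \<in> measurable M (count_space C)"
  shows "(\<forall>i\<in>I. distr M (count_space C) (Z i) = uniform_count_measure C) \<and>
      kwise_indep_vars k (\<lambda>_. count_space C) Z I \<longleftrightarrow>
    (\<forall>S\<subseteq>I. card S \<le> k \<longrightarrow> point_uniform C Z S)" (is "?L \<longleftrightarrow> ?R")
proof
  assume L: ?L
  have single: "prob {\<omega> \<in> space M. Z i \<omega> = c} = 1 / card C" if "i \<in> I" "c \<in> C" for i c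
  proof -
    have "measure (distr M (count_space C) (Z i)) {c} = 1 / card C"
      using L that assms(2) by (simp add: measure_uniform_count_measure)
    then show ?thesis
      using that Z[of i] by (simp add: measure_distr vimage_def Int_def conj_commute)
  qed
  show ?R
  proof (intro allI impI)
    fix S assume S: "S \<subseteq> I" "card S \<le> k"
    then have "finite S" using assms(1) finite_subset by blast
    then have ind: "indep_vars (\<lambda>_. count_space C) Z S"
      using L S by (simp add: kwise_indep_vars_def)
    show "point_uniform C Z S"
      unfolding point_uniform_def
    proof
      fix z assume "z \<in> S \<rightarrow> C"
      have "prob {\<omega> \<in> space M. \<forall>s\<in>S. Z s \<omega> = z s} = (\<Prod>s\<in>S. prob {\<omega> \<in> space M. Z s \<omega> = z s})"
        using ind \<open>finite S\<close> by (intro indep_vars_prob_Ball) auto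
      also have "\<dots> = (\<Prod>s\<in>S. 1 / card C)"
        using S \<open>z \<in> S \<rightarrow> C\<close> by (intro prod.cong refl single) auto
      finally show "prob {\<omega> \<in> space M. \<forall>s\<in>S. Z s \<omega> = z s} = (1 / card C) ^ card S"
        by simp
    qed
  qed
next
  assume R: ?R
  have "distr M (count_space C) (Z i) = uniform_count_measure C" if "i \<in> I" for i
  proof (rule measure_eqI_countable[of _ C])
    fix c assume "c \<in> C"
    have "prob {\<omega> \<in> space M. Z i \<omega> = c} = 1 / card C"
      using point_uniform_prob[of "{i}" C Z "\<lambda>_. {c}"] assms R that \<open>c \<in> C\<close> by simp
    then show "emeasure (distr M (count_space C) (Z i)) {c} = emeasure (uniform_count_measure C) {c}"
      using \<open>c \<in> C\<close> assms(2) Z[OF that]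
      by (simp add: emeasure_distr emeasure_uniform_count_measure emeasure_eq_measure
          vimage_def Int_def conj_commute)
  qed (use assms in \<open>auto simp: sets_uniform_count_measure countable_finite\<close>)
  moreover have "kwise_indep_vars k (\<lambda>_. count_space C) Z I"
    unfolding kwise_indep_vars_def
  proof (intro allI impI, elim conjE)
    fix J assume J: "J \<subseteq> I" "finite J" "card J \<le> k"
    have "point_uniform C Z S" if "S \<subseteq> J" for S
      using R J that by (meson card_mono order_trans)
    then show "indep_vars (\<lambda>_. count_space C) Z J"
      using J assms by (intro point_uniform_indep_vars) auto
  qed
  ultimately show ?L by blast
qed

text \<open>Transfers the condition from the image measure to events in \<open>M\<close>, the space
  on which all the vectors are defined together.\<close>

lemma random_vector_in_iff:
  assumes "finite I" "k \<ge> 1" "r \<ge> 1"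
  shows "random_vector_in M X r I k \<longleftrightarrow> X \<in> measurable M (vec_space r I) \<and>
    (\<forall>S\<subseteq>I. card S \<le> k \<longrightarrow> point_uniform (cyc r) (\<lambda>i \<omega>. X \<omega> i) S)"
proof (cases "X \<in> measurable M (vec_space r I)")
  case True
  define P where "P = distr M (vec_space r I) X"
  interpret P: prob_space P
    unfolding P_def by (rule prob_space_distr[OF True])
  have coord: "(\<lambda>x. x i) \<in> measurable P (count_space (cyc r))" if "i \<in> I" for i
    using that by (simp add: P_def vec_space_def)
  have "P.point_uniform (cyc r) (\<lambda>i x. x i) S \<longleftrightarrow> point_uniform (cyc r) (\<lambda>i \<omega>. X \<omega> i) S"
    if "S \<subseteq> I" for S
  proof -
    have "measure P {x \<in> space P. \<forall>s\<in>S. x s = z s} = prob {\<omega> \<in> space M. \<forall>s\<in>S. X \<omega> s = z s}" for z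
    proof -
      have "finite S" using that assms(1) finite_subset by blast
      then have "{x \<in> space P. \<forall>s\<in>S. x s = z s} \<in> sets P"
        using that coord by (intro sets_Ball_count_space) auto
      then show ?thesis
        using measurable_space[OF True] unfolding P_def
        by (subst measure_distr[OF True]) (auto intro!: arg_cong[where f=prob])
    qed
    then show ?thesis
      by (simp add: P.point_uniform_def point_uniform_def)
  qed
  moreover have "finite (cyc r)" "cyc r \<noteq> {}"
    using assms(3) by (auto simp: cyc_pos)
  moreover have "random_vector_in M X r I k \<longleftrightarrow>
      (\<forall>i\<in>I. distr P (count_space (cyc r)) (\<lambda>x. x i) = uniform_count_measure (cyc r)) \<and>
      P.kwise_indep_vars k (\<lambda>_. count_space (cyc r)) (\<lambda>i x. x i) I"
    using True P.prob_space_axioms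
    by (simp add: random_vector_in_def kwise_dists_def flip: P_def) (simp add: P_def)
  ultimately show ?thesis
    using P.uniform_coords_kwise_indep_iff[of I "cyc r" k "\<lambda>i x. x i"] assms coord True by simp
qed (simp add: random_vector_in_def)

section \<open>Masking by addition modulo \<open>r\<close>\<close>

text \<open>Fix the values of \<open>V\<close> and solve for \<open>U\<close> with
  \<open>add_mod_eq_iff\<close>. \<open>V\<close> may be fixed on a set \<open>D\<close> larger than
  \<open>B\<close>, so that sums belonging to different \<open>B\<close> can be compared term by
  term.\<close>

lemma prob_sum_mod:
  assumes "finite D" "B \<subseteq> D" "r \<ge> 1" "z \<in> B \<rightarrow> cyc r"
    and U: "\<And>s. s \<in> D \<Longrightarrow> U s \<in> measurable M (count_space (cyc r))"
    and V: "\<And>s. s \<in> D \<Longrightarrow> V s \<in> measurable M (count_space (cyc r))"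
  shows "prob {\<omega> \<in> space M. \<forall>s\<in>B. (U s \<omega> + V s \<omega>) mod int r = z s} =
    (\<Sum>v\<in>D \<rightarrow>\<^sub>E cyc r. prob {\<omega> \<in> space M.
       (\<forall>s\<in>B. U s \<omega> = (z s - v s) mod int r) \<and> (\<forall>s\<in>D. V s \<omega> = v s)})"
proof -
  have sp: "U s \<omega> \<in> cyc r" "V s \<omega> \<in> cyc r" if "s \<in> D" "\<omega> \<in> space M" for s \<omega>
    using measurable_space[OF U[OF that(1)] that(2)] measurable_space[OF V[OF that(1)] that(2)]
    by simp_all
  have "{\<omega> \<in> space M. \<forall>s\<in>B. (U s \<omega> + V s \<omega>) mod int r = z s} \<in> events"
    using assms(1-3) U V
    by (intro sets_Ball_count_space[where C="cyc r"] measurable_add_mod) (auto dest: finite_subset)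
  from prob_sum_PiE[OF \<open>finite D\<close> V finite_cyc[OF assms(3)] this]
  have "prob {\<omega> \<in> space M. \<forall>s\<in>B. (U s \<omega> + V s \<omega>) mod int r = z s} =
    (\<Sum>v\<in>D \<rightarrow>\<^sub>E cyc r. prob {\<omega> \<in> space M.
       (\<forall>s\<in>B. (U s \<omega> + V s \<omega>) mod int r = z s) \<and> (\<forall>s\<in>D. V s \<omega> = v s)})"
    using sp by (simp cong: conj_cong)
  also have "\<dots> = (\<Sum>v\<in>D \<rightarrow>\<^sub>E cyc r. prob {\<omega> \<in> space M.
       (\<forall>s\<in>B. U s \<omega> = (z s - v s) mod int r) \<and> (\<forall>s\<in>D. V s \<omega> = v s)})"
  proof (intro sum.cong refl arg_cong[where f=prob] Collect_cong)
    fix v \<omega>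
    have "(U s \<omega> + V s \<omega>) mod int r = z s \<longleftrightarrow> U s \<omega> = (z s - v s) mod int r"
      if "\<omega> \<in> space M" "V s \<omega> = v s" "s \<in> B" for s
    proof -
      have "s \<in> D" "z s \<in> cyc r"
        using that assms(2,4) by auto
      then show ?thesis
        using add_mod_eq_iff[OF assms(3) sp(1)[OF _ that(1)], of s "z s" "v s"] that(2) by simp
    qed
    then show "\<omega> \<in> space M \<and> (\<forall>s\<in>B. (U s \<omega> + V s \<omega>) mod int r = z s) \<and> (\<forall>s\<in>D. V s \<omega> = v s) \<longleftrightarrow>
        \<omega> \<in> space M \<and> (\<forall>s\<in>B. U s \<omega> = (z s - v s) mod int r) \<and> (\<forall>s\<in>D. V s \<omega> = v s)"
      using assms(2) by (auto simp: subset_iff)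
  qed
  finally show ?thesis .
qed

text \<open>The hypothesis on \<open>U\<close> says that its part on \<open>S - T\<close> is uniform and independent of its part on
  \<open>T\<close>. Summing over the values of \<open>V\<close> on all of \<open>S\<close> splits off the coordinates in \<open>S - T\<close> without
  any assumption on \<open>V\<close> there; summing over the values of \<open>U\<close> on \<open>T\<close> then disposes of the rest.\<close>

lemma one_time_pad:
  assumes S: "finite S" "T \<subseteq> S" and r: "r \<ge> 1"
    and U: "\<And>s. s \<in> S \<Longrightarrow> U s \<in> measurable M (count_space (cyc r))"
    and V: "\<And>s. s \<in> S \<Longrightarrow> V s \<in> measurable M (count_space (cyc r))"
    and indep: "\<And>B D u v. B \<subseteq> S \<Longrightarrow> D \<subseteq> S \<Longrightarrow>
      prob {\<omega> \<in> space M. (\<forall>s\<in>B. U s \<omega> = u s) \<and> (\<forall>s\<in>D. V s \<omega> = v s)} =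
      prob {\<omega> \<in> space M. \<forall>s\<in>B. U s \<omega> = u s} * prob {\<omega> \<in> space M. \<forall>s\<in>D. V s \<omega> = v s}"
    and U_unif: "\<And>u. u \<in> S \<rightarrow> cyc r \<Longrightarrow> prob {\<omega> \<in> space M. \<forall>s\<in>S. U s \<omega> = u s} =
      (1 / r) ^ card (S - T) * prob {\<omega> \<in> space M. \<forall>s\<in>T. U s \<omega> = u s}"
    and V_unif: "point_uniform (cyc r) V T"
  shows "point_uniform (cyc r) (\<lambda>s \<omega>. (U s \<omega> + V s \<omega>) mod int r) S"
  unfolding point_uniform_def
proof
  fix z assume z: "z \<in> S \<rightarrow> cyc r"
  have "finite T" using S finite_subset by blast
  have diff: "(\<lambda>s. (a s - b s) mod int r) \<in> R \<rightarrow> cyc r" for a b :: "'b \<Rightarrow> int" and R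
    using r by (simp add: cyc_pos)
  have zT: "z \<in> T \<rightarrow> cyc r" using z S by auto
  let ?d = "\<lambda>v s. (z s - v s) mod int r"
  have "prob {\<omega> \<in> space M. \<forall>s\<in>S. (U s \<omega> + V s \<omega>) mod int r = z s} =
    (\<Sum>v\<in>S \<rightarrow>\<^sub>E cyc r. prob {\<omega> \<in> space M. (\<forall>s\<in>S. U s \<omega> = ?d v s) \<and> (\<forall>s\<in>S. V s \<omega> = v s)})"
    using S r z U V by (intro prob_sum_mod) auto
  \<comment> \<open>\<open>indep\<close> acts twice: with \<open>B = S\<close> it separates
    \<open>U\<close> from \<open>V\<close>, and after \<open>U_unif\<close> has reduced
    \<open>S\<close> to \<open>T\<close> on the side of \<open>U\<close>, it joins the two again
    with \<open>B = T\<close>.\<close>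
  also have "\<dots> = (\<Sum>v\<in>S \<rightarrow>\<^sub>E cyc r. (1 / r) ^ card (S - T) *
      prob {\<omega> \<in> space M. (\<forall>s\<in>T. U s \<omega> = ?d v s) \<and> (\<forall>s\<in>S. V s \<omega> = v s)})"
    using S by (intro sum.cong refl) (simp add: indep U_unif[OF diff])
  \<comment> \<open>\<open>prob_sum_mod\<close> read backwards with \<open>B = T\<close> but
    \<open>D = S\<close>: the values of \<open>V\<close> on \<open>S - T\<close> are summed out,
    however they depend on those on \<open>T\<close>.\<close>
  also have "\<dots> = (1 / r) ^ card (S - T) *
      prob {\<omega> \<in> space M. \<forall>s\<in>T. (U s \<omega> + V s \<omega>) mod int r = z s}"
    using S r zT U V by (subst prob_sum_mod[of S T]) (auto simp: sum_distrib_left)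
  \<comment> \<open>The roles are exchanged: on \<open>T\<close> the mask is \<open>V\<close>, which
    hits the required value with the same probability for every value of \<open>U\<close>.\<close>
  also have "prob {\<omega> \<in> space M. \<forall>s\<in>T. (U s \<omega> + V s \<omega>) mod int r = z s} =
      prob {\<omega> \<in> space M. \<forall>s\<in>T. (V s \<omega> + U s \<omega>) mod int r = z s}"
    by (simp add: add.commute)
  also have "\<dots> =
    (\<Sum>u\<in>T \<rightarrow>\<^sub>E cyc r. prob {\<omega> \<in> space M. (\<forall>s\<in>T. V s \<omega> = ?d u s) \<and> (\<forall>s\<in>T. U s \<omega> = u s)})"
    using S \<open>finite T\<close> r zT U V by (intro prob_sum_mod) auto
  also have "\<dots> = (\<Sum>u\<in>T \<rightarrow>\<^sub>E cyc r. (1 / r) ^ card T * prob {\<omega> \<in> space M. \<forall>s\<in>T. U s \<omega> = u s})"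
  proof (intro sum.cong refl)
    fix u
    have "prob {\<omega> \<in> space M. \<forall>s\<in>T. V s \<omega> = ?d u s} = (1 / r) ^ card T"
      using V_unif diff[of z u T] r unfolding point_uniform_def by (auto simp: cyc_pos)
    then show "prob {\<omega> \<in> space M. (\<forall>s\<in>T. V s \<omega> = ?d u s) \<and> (\<forall>s\<in>T. U s \<omega> = u s)} =
        (1 / r) ^ card T * prob {\<omega> \<in> space M. \<forall>s\<in>T. U s \<omega> = u s}"
      using indep[of T T u "?d u"] S by (simp add: conj_commute mult.commute)
  qed
  also have "\<dots> = (1 / r) ^ card T * (\<Sum>u\<in>T \<rightarrow>\<^sub>E cyc r. prob {\<omega> \<in> space M. \<forall>s\<in>T. U s \<omega> = u s})"
    by (simp add: sum_distrib_left)
  \<comment> \<open>Whatever the distribution of \<open>U\<close> on \<open>T\<close>, its point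
    probabilities add up to 1.\<close>
  also have "(\<Sum>u\<in>T \<rightarrow>\<^sub>E cyc r. prob {\<omega> \<in> space M. \<forall>s\<in>T. U s \<omega> = u s}) =
      prob {\<omega> \<in> space M. \<forall>s\<in>T. U s \<omega> \<in> cyc r}"
    using prob_sum_PiE[OF \<open>finite T\<close> U finite_cyc[OF r], of "\<lambda>s. s" "\<lambda>_. True"] S
    by (simp add: subset_iff)
  also have "{\<omega> \<in> space M. \<forall>s\<in>T. U s \<omega> \<in> cyc r} = space M"
    using measurable_space[OF U] S(2) by (auto simp: subset_iff)
  also have "(1 / r) ^ card (S - T) * ((1 / r) ^ card T * prob (space M)) = (1 / r) ^ card S"
    using S \<open>finite T\<close> by (simp add: prob_space card_Diff_subset card_mono flip: power_add)
  finally show "prob {\<omega> \<in> space M. \<forall>s\<in>S. (U s \<omega> + V s \<omega>) mod int r = z s} =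
      (1 / card (cyc r)) ^ card S"
    using r by (simp add: cyc_pos)
qed

section \<open>Families of independent rows\<close>

text \<open>\<open>Sigma I R\<close> selects the columns \<open>R i\<close> in row \<open>i\<close>;
  grouping by rows leaves one event per random vector.\<close>

lemma indep_vars_prob_Sigma:
  assumes "indep_vars (\<lambda>_. vec_space r J) W I" "finite I" "\<And>i. i \<in> I \<Longrightarrow> finite (R i) \<and> R i \<subseteq> J"
  shows "prob {\<omega> \<in> space M. \<forall>p\<in>Sigma I R. W (fst p) \<omega> (snd p) = z p} =
    (\<Prod>i\<in>I. prob {\<omega> \<in> space M. \<forall>j\<in>R i. W i \<omega> j = z (i, j)})"
proof -
  have "prob {\<omega> \<in> space M. \<forall>i\<in>I. \<forall>j\<in>R i. W i \<omega> j = z (i, j)} =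
      (\<Prod>i\<in>I. prob {\<omega> \<in> space M. \<forall>j\<in>R i. W i \<omega> j = z (i, j)})"
    using assms(3)
    by (intro indep_vars_prob_Ball[OF assms(1,2)] sets_Ball_count_space[where C="cyc r"]
        measurable_vec_space_component) auto
  moreover have "{\<omega> \<in> space M. \<forall>p\<in>Sigma I R. W (fst p) \<omega> (snd p) = z p} =
      {\<omega> \<in> space M. \<forall>i\<in>I. \<forall>j\<in>R i. W i \<omega> j = z (i, j)}"
    by auto
  ultimately show ?thesis by simp
qed

text \<open>The row probabilities multiply, and the exponents \<open>card (R i)\<close> add up to
  \<open>card (Sigma I R)\<close>.\<close>

lemma point_uniform_Sigma:
  assumes "indep_vars (\<lambda>_. vec_space r J) W I" "finite I" "\<And>i. i \<in> I \<Longrightarrow> finite (R i) \<and> R i \<subseteq> J"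
    and "\<And>i. i \<in> I \<Longrightarrow> point_uniform (cyc r) (\<lambda>j \<omega>. W i \<omega> j) (R i)"
  shows "point_uniform (cyc r) (\<lambda>p \<omega>. W (fst p) \<omega> (snd p)) (Sigma I R)"
  unfolding point_uniform_def
proof
  fix z assume z: "z \<in> Sigma I R \<rightarrow> cyc r"
  have "prob {\<omega> \<in> space M. \<forall>p\<in>Sigma I R. W (fst p) \<omega> (snd p) = z p} =
      (\<Prod>i\<in>I. prob {\<omega> \<in> space M. \<forall>j\<in>R i. W i \<omega> j = z (i, j)})"
    by (rule indep_vars_prob_Sigma[OF assms(1-3)])
  also have "\<dots> = (\<Prod>i\<in>I. (1 / card (cyc r)) ^ card (R i))"
  proof (intro prod.cong refl)
    fix i assume "i \<in> I"
    then have "(\<lambda>j. z (i, j)) \<in> R i \<rightarrow> cyc r" using z by auto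
    then show "prob {\<omega> \<in> space M. \<forall>j\<in>R i. W i \<omega> j = z (i, j)} = (1 / card (cyc r)) ^ card (R i)"
      using assms(4)[OF \<open>i \<in> I\<close>] unfolding point_uniform_def by auto
  qed
  also have "\<dots> = (1 / card (cyc r)) ^ card (Sigma I R)"
    using assms(2,3) by (simp add: power_sum)
  finally show "prob {\<omega> \<in> space M. \<forall>p\<in>Sigma I R. W (fst p) \<omega> (snd p) = z p} =
      (1 / card (cyc r)) ^ card (Sigma I R)" .
qed

section \<open>The sum of the two families\<close>

lemma random_vector_in_sum:
  assumes I: "finite I" and J: "finite J" and k: "k \<ge> 1" and r: "r \<ge> 1"
    and X: "\<And>i. i \<in> I \<Longrightarrow> random_vector_in M (X i) r J k"
    and Y: "\<And>i. i \<in> I \<Longrightarrow> random_vector_in M (Y i) r J (l * k + l + k)"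
    and X_indep: "indep_vars (\<lambda>_. vec_space r J) X I"
    and XY_indep: "indep_var
      (PiM I (\<lambda>_. vec_space r J)) (\<lambda>\<omega>. \<lambda>i\<in>I. X i \<omega>)
      (PiM I (\<lambda>_. vec_space r J)) (\<lambda>\<omega>. \<lambda>i\<in>I. Y i \<omega>)"
    and Y_indep: "kwise_indep_vars l (\<lambda>_. vec_space r J) Y I"
  shows "random_vector_in M
    (\<lambda>\<omega>. \<lambda>(i, j)\<in>I \<times> J. X i \<omega> j \<otimes>\<^bsub>integer_mod_group r\<^esub> Y i \<omega> j)
    r (I \<times> J) (l * k + l + k)" (is "random_vector_in M ?Z r _ ?K")
proof -
  define U V where "U p \<omega> = X (fst p) \<omega> (snd p)" and "V p \<omega> = Y (fst p) \<omega> (snd p)" for p \<omega>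
  have K: "?K \<ge> 1" using k by simp
  note X' = X[unfolded random_vector_in_iff[OF J k r]]
  note Y' = Y[unfolded random_vector_in_iff[OF J K r]]
  have U: "U p \<in> measurable M (count_space (cyc r))" and
    V: "V p \<in> measurable M (count_space (cyc r))" if "p \<in> I \<times> J" for p
    using that X' Y' unfolding U_def V_def
    by (auto intro!: measurable_compose[OF _ measurable_vec_space_component[of _ J]])
  have Z: "?Z \<omega> p = (U p \<omega> + V p \<omega>) mod int r" if "p \<in> I \<times> J" for p \<omega>
    using that by (auto simp: U_def V_def)
  have "?Z = (\<lambda>\<omega>. \<lambda>p\<in>I \<times> J. (U p \<omega> + V p \<omega>) mod int r)"
    using Z by (intro ext) (metis (no_types, lifting) restrict_apply)
  also have "\<dots> \<in> measurable M (vec_space r (I \<times> J))"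
    unfolding vec_space_def by (intro measurable_restrict measurable_add_mod r U V)
  finally have Z_meas: "?Z \<in> measurable M (vec_space r (I \<times> J))" .
  have "point_uniform (cyc r) (\<lambda>p \<omega>. ?Z \<omega> p) S" if S: "S \<subseteq> I \<times> J" "card S \<le> ?K" for S
  proof -
    have fin_S: "finite S"
      using S(1) I J by (meson finite_SigmaI finite_subset)
    define R where "R i = S `` {i}" for i
    have R: "finite (R i) \<and> R i \<subseteq> J" for i
      using S(1) J unfolding R_def by (auto intro: finite_subset)
    have S_eq: "S = Sigma I R"
      using S(1) by (auto simp: R_def)
    \<comment> \<open>No row of \<open>S\<close> is too large for the hypothesis on a single
      \<open>Y i\<close>, so that heavy rows of \<open>Y\<close> are uniform one by one.\<close>
    have card_R: "card (R i) \<le> ?K" if "i \<in> I" for i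
    proof -
      have "card (R i) \<le> (\<Sum>i\<in>I. card (R i))"
        using that I by (intro member_le_sum) auto
      also have "\<dots> = card S"
        using I R by (simp add: S_eq)
      finally show ?thesis using S(2) by simp
    qed
    define A where "A = {i \<in> I. card (R i) > k}"
    have A: "A \<subseteq> I" "finite A" using I by (auto simp: A_def)
    \<comment> \<open>Otherwise \<open>l + 1\<close> heavy rows with at least \<open>k + 1\<close>
      pairs each would give \<open>(l + 1) * (k + 1) = ?K + 1\<close> pairs in
      \<open>S\<close>.\<close>
    have "card A \<le> l"
    proof (rule ccontr)
      assume "\<not> card A \<le> l"
      then have "(l + 1) * (k + 1) \<le> card A * (k + 1)"
        by (intro mult_le_mono1) simp
      also have "\<dots> \<le> (\<Sum>i\<in>A. card (R i))"
        using sum_bounded_below[of A "k + 1" "\<lambda>i. card (R i)"] by (simp add: A_def)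
      also have "\<dots> \<le> (\<Sum>i\<in>I. card (R i))"
        using A I by (intro sum_mono2) auto
      also have "\<dots> = card S"
        using I R by (simp add: S_eq)
      finally show False using S(2) by simp
    qed
    have "point_uniform (cyc r) (\<lambda>p \<omega>. (U p \<omega> + V p \<omega>) mod int r) S"
    proof (rule one_time_pad[of S "Sigma A R"])
      show "prob {\<omega> \<in> space M. (\<forall>s\<in>B. U s \<omega> = u s) \<and> (\<forall>s\<in>D. V s \<omega> = v s)} =
          prob {\<omega> \<in> space M. \<forall>s\<in>B. U s \<omega> = u s} * prob {\<omega> \<in> space M. \<forall>s\<in>D. V s \<omega> = v s}"
        if BD: "B \<subseteq> S" "D \<subseteq> S" for B D u v
      proof -
        have fin: "finite B" "finite D" and sub: "B \<subseteq> I \<times> J" "D \<subseteq> I \<times> J"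
          using BD fin_S S(1) finite_subset by blast+
        \<comment> \<open>On row indices in \<open>I\<close> the restricted families agree with
          \<open>X\<close> and \<open>Y\<close>, so events about \<open>U\<close> and
          \<open>V\<close> are events about the two points of the product space in
          \<open>XY_indep\<close>.\<close>
        have eqs: "(\<forall>p\<in>B. (\<lambda>i\<in>I. X i \<omega>) (fst p) (snd p) = u p) \<longleftrightarrow> (\<forall>p\<in>B. U p \<omega> = u p)"
          "(\<forall>p\<in>D. (\<lambda>i\<in>I. Y i \<omega>) (fst p) (snd p) = v p) \<longleftrightarrow> (\<forall>p\<in>D. V p \<omega> = v p)" for \<omega>
          using sub by (auto simp: U_def V_def intro!: ball_cong)
        show ?thesis
          using indep_var_prob_conj[OF XY_indep sets_PiM_vec_space_Ball[OF fin(1) sub(1), where z=u]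
              sets_PiM_vec_space_Ball[OF fin(2) sub(2), where z=v]]
          unfolding eqs .
      qed
      show "prob {\<omega> \<in> space M. \<forall>s\<in>S. U s \<omega> = u s} = (1 / r) ^ card (S - Sigma A R) *
          prob {\<omega> \<in> space M. \<forall>s\<in>Sigma A R. U s \<omega> = u s}" if u: "u \<in> S \<rightarrow> cyc r" for u
      proof -
        let ?p = "\<lambda>i. prob {\<omega> \<in> space M. \<forall>j\<in>R i. X i \<omega> j = u (i, j)}"
        have prod: "prob {\<omega> \<in> space M. \<forall>s\<in>Sigma B R. U s \<omega> = u s} = prod ?p B" if "B \<subseteq> I" for B
          unfolding U_def using that I R
          by (intro indep_vars_prob_Sigma[OF indep_vars_subset[OF X_indep]]) (auto dest: finite_subset)
        \<comment> \<open>Rows outside \<open>A\<close> have at most \<open>k\<close> pairs, which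
          is what the hypothesis on \<open>X\<close> covers.\<close>
        have "point_uniform (cyc r) U (Sigma (I - A) R)"
          unfolding U_def using I R X'
          by (intro point_uniform_Sigma[OF indep_vars_subset[OF X_indep]]) (auto simp: A_def)
        moreover have "S - Sigma A R = Sigma (I - A) R"
          using S_eq by auto
        moreover have "u \<in> Sigma (I - A) R \<rightarrow> cyc r"
          using u S_eq by auto
        ultimately have "prod ?p (I - A) = (1 / r) ^ card (S - Sigma A R)"
          using prod[of "I - A"] r by (auto simp: point_uniform_def cyc_pos)
        \<comment> \<open>The product over all rows is the product over the light rows, just
          computed, times the one over the heavy rows.\<close>
        then show ?thesis
          using prod[of I] prod[of A] prod.subset_diff[of A I ?p] A I S_eq by simp
      qed
      \<comment> \<open>The bound on the number of heavy rows is what makes \<open>l\<close>-wise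
        independence of the \<open>Y i\<close> sufficient.\<close>
      have "indep_vars (\<lambda>_. vec_space r J) Y A"
        using Y_indep A \<open>card A \<le> l\<close> by (simp add: kwise_indep_vars_def)
      then show "point_uniform (cyc r) V (Sigma A R)"
        unfolding V_def using A R Y' card_R by (intro point_uniform_Sigma) auto
    qed (use fin_S r S U V A S_eq in auto)
    moreover have "(\<forall>p\<in>S. ?Z \<omega> p = z p) \<longleftrightarrow> (\<forall>p\<in>S. (U p \<omega> + V p \<omega>) mod int r = z p)" for \<omega> z
      by (intro ball_cong refl) (subst Z[OF subsetD[OF S(1)]], assumption, rule refl)
    ultimately show ?thesis
      by (simp only: point_uniform_def)
  qed
  then show ?thesis
    using Z_meas I J K r by (subst random_vector_in_iff) auto
qed

end

theorem lemma29:
  fixes M :: "'a measure"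
    and X Y :: "nat \<Rightarrow> 'a \<Rightarrow> nat \<Rightarrow> int"
    and l m n k r :: nat
  assumes "l \<ge> 1" "m \<ge> 1" "n \<ge> 1" "k \<ge> 1" "r \<ge> 1"
    and "prob_space M"
    and "\<And>i. i \<in> {1..m} \<Longrightarrow> random_vector_in M (X i) r {1..n} k"
    and "\<And>i. i \<in> {1..m} \<Longrightarrow> random_vector_in M (Y i) r {1..n} (l * k + l + k)"
    and "prob_space.indep_vars M (\<lambda>_. vec_space r {1..n}) X {1..m}"
    and "prob_space.indep_var M
           (PiM {1..m} (\<lambda>_. vec_space r {1..n})) (\<lambda>\<omega>. \<lambda>i\<in>{1..m}. X i \<omega>)
           (PiM {1..m} (\<lambda>_. vec_space r {1..n})) (\<lambda>\<omega>. \<lambda>i\<in>{1..m}. Y i \<omega>)"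
    and "prob_space.kwise_indep_vars M l (\<lambda>_. vec_space r {1..n}) Y {1..m}"
  shows "random_vector_in M
           (\<lambda>\<omega>. \<lambda>(i, j)\<in>{1..m} \<times> {1..n}. X i \<omega> j \<otimes>\<^bsub>integer_mod_group r\<^esub> Y i \<omega> j)
           r ({1..m} \<times> {1..n}) (l * k + l + k)"
  using assms(4-) by (intro prob_space.random_vector_in_sum) auto

end
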